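(* Let $T$ be a nontrivial finite metric tree of length $L=|T|$ and metric radius $\rho$, and let $r>0$. There is a probability measure $\nu$ supported on one-ball covers in $\mathcal C(T,0)$ whose expected radius measure satisfies $E_\nu\le\frac{L}{r}\,U[0,r]$ if and only if $$r^2\le L(r-\rho).$$
   Context: A finite metric tree is the metric realization of a finite combinatorial tree whose edges have positive lengths; it is nontrivial if it is not a single point. $|T|$ is the total edge length, $d_T$ the path metric, $B_T(v,s)=\{x\in T: d_T(x,v)\le s\}$, and the metric radius is $\min_{v\in T}\max_{x\in T}d_T(v,x)$. For $m\ge1$, a tuple $\mathbf r=(r_1,\dots,r_m)\in\mathbb R_{\ge0}^m$ is a cover of $T$ if there are $v_1,\dots,v_m\in T$ with $T\subseteq\bigcup_i B_T(v_i,r_i)$; $\mathcal C_m(T)$ is the set of such tuples, $\mathcal C(T)=\bigsqcup_{m\ge1}\mathcal C_m(T)$ with the disjoint-union Borel structure, and $\mathcal C(T,0)=\{\mathbf r\in\mathcal C(T):\sum_i r_i\le|T|\}$. One-ball covers are the covers with $m=1$. For a finite Borel measure $\nu$ on $\mathcal C(T)$, the expected radius measure is $E_\nu(A)=\int|\{i:r_i\in A\}|\,d\nu(\mathbf r)$ for Borel $A\subseteq\mathbb R_{\ge0}$. $\mu\le\mu'$ means $\mu(A)\le\mu'(A)$ for all Borel $A$. $U[0,r]$ is the uniform probability measure on $[0,r]$, viewed as a measure on $\mathbb R_{\ge0}$. *)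

theory Defs
  imports "HOL-Probability.Probability"
begin

section \<open>Finite combinatorial trees with edge lengths\<close>

record 'v weighted_graph =
  verts :: "'v set"
  edges :: "'v set set"
  elen :: "'v set \<Rightarrow> real"

definition adjacent :: "'v weighted_graph \<Rightarrow> 'v \<Rightarrow> 'v \<Rightarrow> bool" where
  "adjacent T u v \<longleftrightarrow> {u, v} \<in> edges T"

definition is_cycle :: "'v weighted_graph \<Rightarrow> 'v list \<Rightarrow> bool" where
  "is_cycle T c \<longleftrightarrow> 3 \<le> length c \<and> distinct c \<and> successively (adjacent T) c \<and> adjacent T (last c) (hd c)"

definition finite_metric_tree :: "'v weighted_graph \<Rightarrow> bool" where
  "finite_metric_tree T \<longleftrightarrow>
     finite (verts T) \<and> verts T \<noteq> {} \<and>
     edges T \<subseteq> {e. e \<subseteq> verts T \<and> card e = 2} \<and>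
     (\<forall>u\<in>verts T. \<forall>v\<in>verts T. (adjacent T)\<^sup>*\<^sup>* u v) \<and>
     (\<nexists>c. is_cycle T c) \<and>
     (\<forall>e\<in>edges T. 0 < elen T e)"

definition total_length :: "'v weighted_graph \<Rightarrow> real" where
  "total_length T = (\<Sum>e\<in>edges T. elen T e)"

section \<open>The metric realization\<close>

text \<open>
  The underlying set is the geometric realization in barycentric coordinates: a point is a
  convex combination of vertices whose support is a single vertex or an edge. On the edge
  \<open>e = {a, b}\<close>, the point \<open>x\<close> lies at distance \<open>elen T e * x b\<close> from \<open>a\<close>.
\<close>

definition points :: "'v weighted_graph \<Rightarrow> ('v \<Rightarrow> real) set" where
  "points T = {x. (\<forall>v. 0 \<le> x v) \<and> (\<Sum>v\<in>verts T. x v) = 1 \<and>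
     ((\<exists>v\<in>verts T. {u. x u \<noteq> 0} = {v}) \<or> {u. x u \<noteq> 0} \<in> edges T)}"

definition closed_edge :: "'v weighted_graph \<Rightarrow> 'v set \<Rightarrow> ('v \<Rightarrow> real) set" where
  "closed_edge T e = {x \<in> points T. {u. x u \<noteq> 0} \<subseteq> e}"

text \<open>
  The length of the segment between two points of the closed edge \<open>e\<close>. The two summands
  agree, because the two coordinates of a point of \<open>e\<close> sum to \<open>1\<close>; hence the factor \<open>1/2\<close>.
\<close>

definition segment_length :: "'v weighted_graph \<Rightarrow> 'v set \<Rightarrow> ('v \<Rightarrow> real) \<Rightarrow> ('v \<Rightarrow> real) \<Rightarrow> real" where
  "segment_length T e x y = elen T e * ((\<Sum>u\<in>e. \<bar>x u - y u\<bar>) / 2)"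

text \<open>\<open>path_of_length T x y s\<close>: some piecewise linear path from \<open>x\<close> to \<open>y\<close> has length \<open>s\<close>.\<close>

inductive path_of_length :: "'v weighted_graph \<Rightarrow> ('v \<Rightarrow> real) \<Rightarrow> ('v \<Rightarrow> real) \<Rightarrow> real \<Rightarrow> bool"
  for T where
  refl: "x \<in> points T \<Longrightarrow> path_of_length T x x 0"
| step: "path_of_length T x y s \<Longrightarrow> e \<in> edges T \<Longrightarrow> y \<in> closed_edge T e \<Longrightarrow> z \<in> closed_edge T e
    \<Longrightarrow> path_of_length T x z (s + segment_length T e y z)"

text \<open>The value \<open>0\<close> off the realization is a dummy, as required by \<^locale>\<open>Metric_space\<close>.\<close>

definition tree_dist :: "'v weighted_graph \<Rightarrow> ('v \<Rightarrow> real) \<Rightarrow> ('v \<Rightarrow> real) \<Rightarrow> real" where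
  "tree_dist T x y =
     (if x \<in> points T \<and> y \<in> points T then Inf {s. path_of_length T x y s} else 0)"

definition tree_ball :: "'v weighted_graph \<Rightarrow> ('v \<Rightarrow> real) \<Rightarrow> real \<Rightarrow> ('v \<Rightarrow> real) set" where
  "tree_ball T v s = {x \<in> points T. tree_dist T x v \<le> s}"

text \<open>Both extrema are attained, see \<open>metric_radius_attained\<close> below.\<close>

definition metric_radius :: "'v weighted_graph \<Rightarrow> real" where
  "metric_radius T = (INF v\<in>points T. SUP x\<in>points T. tree_dist T v x)"

section \<open>Covers and expected radius measures\<close>

text \<open>Tuples in \<open>\<real>\<^sup>m\<close> are extensional functions on \<open>{1..m}\<close>, the points of the product measure space.\<close>

definition covers :: "'v weighted_graph \<Rightarrow> nat \<Rightarrow> (nat \<Rightarrow> real) set" where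
  "covers T m = {r \<in> {1..m} \<rightarrow>\<^sub>E {0..}.
     \<exists>v \<in> {1..m} \<rightarrow> points T. points T \<subseteq> (\<Union>i\<in>{1..m}. tree_ball T (v i) (r i))}"

text \<open>The disjoint union of the Borel spaces \<open>covers T m\<close>, \<open>m \<ge> 1\<close>; only its measurable sets matter.\<close>

definition cover_space :: "'v weighted_graph \<Rightarrow> (nat \<times> (nat \<Rightarrow> real)) measure" where
  "cover_space T = sigma (SIGMA m:{1..}. covers T m)
     {{m} \<times> A | m A. 1 \<le> m \<and> A \<in> sets (restrict_space (Pi\<^sub>M {1..m} (\<lambda>_. borel)) (covers T m))}"

definition covers0 :: "'v weighted_graph \<Rightarrow> (nat \<times> (nat \<Rightarrow> real)) set" where
  "covers0 T = {(m, r). 1 \<le> m \<and> r \<in> covers T m \<and> (\<Sum>i\<in>{1..m}. r i) \<le> total_length T}"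

definition one_ball_covers :: "'v weighted_graph \<Rightarrow> (nat \<times> (nat \<Rightarrow> real)) set" where
  "one_ball_covers T = {1} \<times> covers T 1"

abbreviation nonneg_borel :: "real measure" where
  "nonneg_borel \<equiv> restrict_space borel {0..}"

definition expected_radius_measure :: "(nat \<times> (nat \<Rightarrow> real)) measure \<Rightarrow> real measure" where
  "expected_radius_measure \<nu> = measure_of {0..} (sets nonneg_borel)
     (\<lambda>A. \<integral>\<^sup>+(m, r). of_nat (card {i \<in> {1..m}. r i \<in> A}) \<partial>\<nu>)"

definition uniform_on_nonneg :: "real \<Rightarrow> real measure" where
  "uniform_on_nonneg r = restrict_space (uniform_measure lborel {0..r}) {0..}"

section \<open>Basic facts\<close>

subsection \<open>The realization is a metric space\<close>

lemma edge_cases: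
  assumes "finite_metric_tree T" "e \<in> edges T"
  obtains a b where "e = {a, b}" "a \<noteq> b" "a \<in> verts T" "b \<in> verts T" "0 < elen T e"
proof -
  have "e \<subseteq> verts T" "card e = 2" "0 < elen T e"
    using assms by (auto simp: finite_metric_tree_def)
  then show thesis
    by (metis card_2_iff insert_subset that)
qed

lemma closed_edge_sum:
  assumes "finite_metric_tree T" "{a, b} \<in> edges T" "a \<noteq> b" "x \<in> closed_edge T {a, b}"
  shows "x a + x b = 1"
proof -
  have fin: "finite (verts T)" and sub: "{a, b} \<subseteq> verts T"
    using assms(1,2) by (auto simp: finite_metric_tree_def)
  have "(\<Sum>v\<in>{a, b}. x v) = (\<Sum>v\<in>verts T. x v)"
    using assms(4) by (intro sum.mono_neutral_left fin sub) (auto simp: closed_edge_def)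
  also have "\<dots> = 1" using assms(4) by (auto simp: closed_edge_def points_def)
  finally show ?thesis using assms(3) by simp
qed

lemma segment_length_eq:
  assumes "finite_metric_tree T" "{a, b} \<in> edges T" "a \<noteq> b"
    "x \<in> closed_edge T {a, b}" "y \<in> closed_edge T {a, b}"
  shows "segment_length T {a, b} x y = elen T {a, b} * \<bar>x b - y b\<bar>"
proof -
  have "x a = 1 - x b" "y a = 1 - y b"
    using closed_edge_sum[OF assms(1-3)] assms(4,5) by fastforce+
  then have "\<bar>x a - y a\<bar> = \<bar>x b - y b\<bar>" by linarith
  then show ?thesis using assms(3) by (simp add: segment_length_def)
qed

lemma segment_length_commute: "segment_length T e x y = segment_length T e y x"
  by (simp add: segment_length_def abs_minus_commute)

lemma segment_length_nonneg:
  assumes "finite_metric_tree T" "e \<in> edges T"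
  shows "0 \<le> segment_length T e x y"
proof -
  have "0 < elen T e" using assms by (simp add: finite_metric_tree_def)
  then show ?thesis by (simp add: segment_length_def sum_nonneg)
qed

lemma path_nonneg:
  assumes "finite_metric_tree T" "path_of_length T x y s"
  shows "0 \<le> s"
  using assms(2) by induction (simp_all add: segment_length_nonneg[OF assms(1)])

lemma path_points:
  assumes "path_of_length T x y s" shows "x \<in> points T" "y \<in> points T"
  using assms by induction (auto simp: closed_edge_def)

lemma path_trans:
  assumes "path_of_length T y z t" "path_of_length T x y s"
  shows "path_of_length T x z (s + t)"
  using assms
proof induction
  case (step y' z' t e w)
  then show ?case using path_of_length.step[of T x z' "s + t" e w] by (simp add: add.assoc)
qed simp

lemma path_segment:
  assumes "e \<in> edges T" "y \<in> closed_edge T e" "z \<in> closed_edge T e"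
  shows "path_of_length T y z (segment_length T e y z)"
proof -
  have "path_of_length T y y 0" using assms by (auto simp: closed_edge_def intro: path_of_length.refl)
  from path_of_length.step[OF this assms] show ?thesis by simp
qed

lemma path_sym:
  assumes "path_of_length T x y s" shows "path_of_length T y x s"
  using assms
proof induction
  case (step x y s e z)
  have "path_of_length T z y (segment_length T e y z)"
    using path_segment[of e T z y] step by (simp add: segment_length_commute)
  from path_trans[OF step.IH this] show ?case by (simp add: add.commute)
qed (rule path_of_length.refl)

lemma path_coord_bound:
  assumes T: "finite_metric_tree T" and c: "\<And>e. e \<in> edges T \<Longrightarrow> c \<le> elen T e" and "0 \<le> c"
    and "path_of_length T x y s"
  shows "c * \<bar>x v - y v\<bar> \<le> s"
  using assms(4)
proof induction
  case (step x y s e z)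
  from edge_cases[OF T step(2)] obtain a b where e: "e = {a, b}" "a \<noteq> b" by metis
  have "c * \<bar>y v - z v\<bar> \<le> segment_length T e y z"
  proof (cases "v \<in> e")
    case True
    have "segment_length T e y z = elen T e * \<bar>y v - z v\<bar>"
      using True segment_length_eq[OF T, of a b y z] segment_length_eq[OF T, of b a y z] step e
      by (auto simp: insert_commute)
    then show ?thesis using c[OF step(2)] by (simp add: mult_right_mono)
  next
    case False
    then have "y v = 0" "z v = 0" using step by (auto simp: closed_edge_def)
    then show ?thesis using segment_length_nonneg[OF T step(2)] by simp
  qed
  moreover have "c * \<bar>x v - z v\<bar> \<le> c * (\<bar>x v - y v\<bar> + \<bar>y v - z v\<bar>)"
    using \<open>0 \<le> c\<close> by (intro mult_left_mono) auto
  ultimately show ?case using step.IH by (simp add: algebra_simps)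
qed simp

definition edge_point :: "'v \<Rightarrow> 'v \<Rightarrow> real \<Rightarrow> 'v \<Rightarrow> real" where
  "edge_point a b t = (\<lambda>u. if u = a then 1 - t else if u = b then t else 0)"

lemma edge_point_in:
  assumes T: "finite_metric_tree T" and e: "{a, b} \<in> edges T" "a \<noteq> b" and t: "t \<in> {0..1}"
  shows "edge_point a b t \<in> closed_edge T {a, b}"
proof -
  have fin: "finite (verts T)" and sub: "{a, b} \<subseteq> verts T"
    using T e by (auto simp: finite_metric_tree_def)
  have "(\<Sum>v\<in>verts T. edge_point a b t v) = (\<Sum>v\<in>{a, b}. edge_point a b t v)"
    by (rule sum.mono_neutral_right[OF fin sub]) (auto simp: edge_point_def)
  also have "\<dots> = 1" using e by (simp add: edge_point_def)
  finally have s: "(\<Sum>v\<in>verts T. edge_point a b t v) = 1" .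
  have "{u. edge_point a b t u \<noteq> 0} = (if t = 0 then {a} else if t = 1 then {b} else {a, b})"
    using e(2) by (auto simp: edge_point_def)
  then show ?thesis using s t sub e
    by (auto simp: closed_edge_def points_def edge_point_def)
qed

lemma closed_edge_eq:
  assumes T: "finite_metric_tree T" and e: "{a, b} \<in> edges T" "a \<noteq> b"
  shows "closed_edge T {a, b} = edge_point a b ` {0..1}"
proof
  show "edge_point a b ` {0..1} \<subseteq> closed_edge T {a, b}"
    using edge_point_in[OF T e] by auto
  show "closed_edge T {a, b} \<subseteq> edge_point a b ` {0..1}"
  proof
    fix x assume x: "x \<in> closed_edge T {a, b}"
    have s: "x a + x b = 1" by (rule closed_edge_sum[OF T e x])
    have "0 \<le> x a" "0 \<le> x b" "\<And>u. u \<noteq> a \<Longrightarrow> u \<noteq> b \<Longrightarrow> x u = 0"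
      using x by (auto simp: closed_edge_def points_def)
    then have "x b \<in> {0..1}" "x = edge_point a b (x b)"
      using s by (auto simp: edge_point_def fun_eq_iff)
    then show "x \<in> edge_point a b ` {0..1}" by blast
  qed
qed

lemma points_cases:
  assumes T: "finite_metric_tree T" and x: "x \<in> points T"
  obtains v where "v \<in> verts T" "x = indicator {v}"
  | e where "e \<in> edges T" "x \<in> closed_edge T e"
proof -
  have fin: "finite (verts T)" using T by (simp add: finite_metric_tree_def)
  consider v where "v \<in> verts T" "{u. x u \<noteq> 0} = {v}" | "{u. x u \<noteq> 0} \<in> edges T"
    using x by (auto simp: points_def)
  then show thesis
  proof cases
    case 1
    have "(\<Sum>u\<in>{v}. x u) = (\<Sum>u\<in>verts T. x u)"
      using 1 by (intro sum.mono_neutral_left fin) auto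
    then have "x v = 1" using x by (simp add: points_def)
    moreover have "x u = 0" if "u \<noteq> v" for u using 1 that by blast
    ultimately have "x = indicator {v}" by (auto simp: indicator_def fun_eq_iff)
    with 1 that show ?thesis by blast
  next
    case 2
    with x that show ?thesis by (auto simp: closed_edge_def)
  qed
qed

lemma vertex_point:
  assumes "finite_metric_tree T" "v \<in> verts T"
  shows "indicator {v} \<in> points T"
proof -
  have "{u. (indicator {v} u :: real) \<noteq> 0} = {v}" by (auto simp: indicator_def)
  moreover have "(\<Sum>u\<in>verts T. (indicator {v} u :: real)) = 1"
    using assms by (auto simp: finite_metric_tree_def indicator_def)
  ultimately show ?thesis using assms(2) by (simp add: points_def)
qed

lemma vertex_in_edge:
  assumes "finite_metric_tree T" "e \<in> edges T" "v \<in> e"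
  shows "indicator {v} \<in> closed_edge T e"
proof -
  have "v \<in> verts T" using assms by (auto simp: finite_metric_tree_def)
  from vertex_point[OF assms(1) this] assms(3) show ?thesis
    by (auto simp: closed_edge_def indicator_def)
qed

lemma path_exists:
  assumes T: "finite_metric_tree T" and x: "x \<in> points T" and y: "y \<in> points T"
  shows "\<exists>s. path_of_length T x y s"
proof -
  have to_vertex: "\<exists>v\<in>verts T. \<exists>s. path_of_length T z (indicator {v}) s" if z: "z \<in> points T" for z
    using points_cases[OF T z]
  proof cases
    case (1 v)
    then show ?thesis using z by (auto intro: path_of_length.refl)
  next
    case (2 e)
    obtain a b where "e = {a, b}" "a \<in> verts T" using edge_cases[OF T 2(1)] by metis
    then show ?thesis using path_segment[OF 2 vertex_in_edge[OF T 2(1), of a]] by blast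
  qed
  have between: "\<exists>s. path_of_length T (indicator {u}) (indicator {v}) s"
    if "(adjacent T)\<^sup>*\<^sup>* u v" "u \<in> verts T" for u v
    using that
  proof (induction rule: rtranclp_induct)
    case base
    then show ?case using vertex_point[OF T] by (auto intro: path_of_length.refl)
  next
    case (step v w)
    then have e: "{v, w} \<in> edges T" by (simp add: adjacent_def)
    from step obtain s where "path_of_length T (indicator {u}) (indicator {v}) s" by blast
    from path_of_length.step[OF this e] show ?case using vertex_in_edge[OF T e] by blast
  qed
  obtain u s v t where u: "u \<in> verts T" "path_of_length T x (indicator {u}) s"
    and v: "v \<in> verts T" "path_of_length T y (indicator {v}) t"
    using to_vertex x y by meson
  have "(adjacent T)\<^sup>*\<^sup>* u v" using T u v by (auto simp: finite_metric_tree_def)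
  from between[OF this u(1)] obtain w where "path_of_length T (indicator {u}) (indicator {v}) w" ..
  from path_trans[OF path_sym[OF v(2)] path_trans[OF this u(2)]] show ?thesis by blast
qed

lemma tree_dist_le:
  assumes "finite_metric_tree T" "path_of_length T x y s"
  shows "tree_dist T x y \<le> s"
proof -
  have "bdd_below {s. path_of_length T x y s}"
    using path_nonneg[OF assms(1)] by (auto intro!: bdd_belowI)
  then show ?thesis using assms(2) path_points[OF assms(2)]
    by (auto simp: tree_dist_def intro: cInf_lower)
qed

lemma tree_dist_ge:
  assumes "finite_metric_tree T" "x \<in> points T" "y \<in> points T"
    "\<And>s. path_of_length T x y s \<Longrightarrow> c \<le> s"
  shows "c \<le> tree_dist T x y"
  using path_exists[OF assms(1-3)] assms(2-4)
  by (auto simp: tree_dist_def intro!: cInf_greatest)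

lemma tree_dist_approx:
  assumes "finite_metric_tree T" "x \<in> points T" "y \<in> points T" "0 < \<epsilon>"
  obtains s where "path_of_length T x y s" "s < tree_dist T x y + \<epsilon>"
proof -
  have "\<not> tree_dist T x y + \<epsilon> \<le> tree_dist T x y" using assms(4) by simp
  then show thesis using tree_dist_ge[OF assms(1-3), of "tree_dist T x y + \<epsilon>"] that by force
qed

lemma Metric_space_tree:
  assumes T: "finite_metric_tree T"
  shows "Metric_space (points T) (tree_dist T)"
proof
  fix x y
  show "0 \<le> tree_dist T x y"
    using tree_dist_ge[OF T, of x y 0] path_nonneg[OF T] by (force simp: tree_dist_def)
  have "{s. path_of_length T x y s} = {s. path_of_length T y x s}" using path_sym by blast
  then show "tree_dist T x y = tree_dist T y x" by (auto simp: tree_dist_def)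
next
  fix x y assume x: "x \<in> points T" and y: "y \<in> points T"
  show "tree_dist T x y = 0 \<longleftrightarrow> x = y"
  proof
    assume 0: "tree_dist T x y = 0"
    have "edges T \<subseteq> Pow (verts T)" using T by (auto simp: finite_metric_tree_def)
    then have fin: "finite (edges T)" using T finite_subset by (auto simp: finite_metric_tree_def)
    define c where "c = Min (insert 1 (elen T ` edges T))"
    have c: "0 < c" "\<And>e. e \<in> edges T \<Longrightarrow> c \<le> elen T e"
      using fin T by (auto simp: c_def finite_metric_tree_def)
    have "c * \<bar>x v - y v\<bar> \<le> tree_dist T x y" for v
      by (intro tree_dist_ge[OF T x y] path_coord_bound[OF T c(2)]) (use c in auto)
    then have "x v = y v" for v using 0 c(1)
      by (metis abs_ge_zero abs_le_zero_iff eq_iff_diff_eq_0 mult_le_0_iff not_le)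
    then show "x = y" by blast
  next
    assume "x = y"
    then have "tree_dist T x y \<le> 0" using tree_dist_le[OF T path_of_length.refl[OF x]] by simp
    moreover have "0 \<le> tree_dist T x y" using tree_dist_ge[OF T x y] path_nonneg[OF T] by blast
    ultimately show "tree_dist T x y = 0" by simp
  qed
next
  fix x y z assume x: "x \<in> points T" and y: "y \<in> points T" and z: "z \<in> points T"
  show "tree_dist T x z \<le> tree_dist T x y + tree_dist T y z"
  proof (rule field_le_epsilon)
    fix \<epsilon> :: real assume "0 < \<epsilon>"
    then have h: "0 < \<epsilon> / 2" by simp
    obtain s where s: "path_of_length T x y s" "s < tree_dist T x y + \<epsilon> / 2"
      using tree_dist_approx[OF T x y h] .
    obtain t where t: "path_of_length T y z t" "t < tree_dist T y z + \<epsilon> / 2"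
      using tree_dist_approx[OF T y z h] .
    have "tree_dist T x z \<le> s + t" by (rule tree_dist_le[OF T path_trans[OF t(1) s(1)]])
    then show "tree_dist T x z \<le> tree_dist T x y + tree_dist T y z + \<epsilon>" using s t by simp
  qed
qed

subsection \<open>The metric radius is a minimum of maxima\<close>

lemma points_nonempty: "finite_metric_tree T \<Longrightarrow> points T \<noteq> {}"
  using vertex_point[of T] unfolding finite_metric_tree_def by blast

lemma attains_min:
  assumes T: "finite_metric_tree T"
    and lip: "\<And>x y. x \<in> points T \<Longrightarrow> y \<in> points T \<Longrightarrow> \<bar>g x - g y\<bar> \<le> tree_dist T x y"
  shows "\<exists>x\<in>points T. \<forall>y\<in>points T. (g x :: real) \<le> g y"
proof -
  have edge: "\<exists>x\<in>closed_edge T e. \<forall>y\<in>closed_edge T e. g x \<le> g y" if e: "e \<in> edges T" for e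
  proof -
    obtain a b where ab: "e = {a, b}" "a \<noteq> b" "0 < elen T e" using edge_cases[OF T e] by metis
    have E: "{a, b} \<in> edges T" using e ab by simp
    note ep = edge_point_in[OF T E ab(2)]
    have "\<bar>g (edge_point a b s) - g (edge_point a b t)\<bar> \<le> elen T e * \<bar>s - t\<bar>"
      if "s \<in> {0..1}" "t \<in> {0..1}" for s t
    proof -
      have "\<bar>g (edge_point a b s) - g (edge_point a b t)\<bar> \<le> tree_dist T (edge_point a b s) (edge_point a b t)"
        using ep that by (intro lip) (auto simp: closed_edge_def)
      also have "\<dots> \<le> segment_length T {a, b} (edge_point a b s) (edge_point a b t)"
        by (intro tree_dist_le[OF T] path_segment E ep that)
      also have "\<dots> = elen T e * \<bar>s - t\<bar>"
        using segment_length_eq[OF T E ab(2) ep ep] that ab by (simp add: edge_point_def)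
      finally show ?thesis .
    qed
    then have "(elen T e)-lipschitz_on {0..1} (\<lambda>t. g (edge_point a b t))"
      using ab by (intro lipschitz_onI) (auto simp: dist_real_def)
    then have "continuous_on {0..1} (\<lambda>t. g (edge_point a b t))"
      by (rule lipschitz_on_continuous_on)
    then have "\<exists>s\<in>{0..1}. \<forall>t\<in>{0..1}. g (edge_point a b s) \<le> g (edge_point a b t)"
      by (intro continuous_attains_inf) auto
    then show ?thesis unfolding ab(1) closed_edge_eq[OF T E ab(2)] by auto
  qed
  then obtain m where m: "\<And>e. e \<in> edges T \<Longrightarrow> m e \<in> closed_edge T e"
    "\<And>e y. e \<in> edges T \<Longrightarrow> y \<in> closed_edge T e \<Longrightarrow> g (m e) \<le> g y"
    by metis
  define S where "S = m ` edges T \<union> (\<lambda>v. indicator {v}) ` verts T"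
  have "edges T \<subseteq> Pow (verts T)" using T by (auto simp: finite_metric_tree_def)
  moreover have V: "finite (verts T)" "verts T \<noteq> {}" using T by (auto simp: finite_metric_tree_def)
  ultimately have "finite (edges T)" using finite_subset by blast
  with V have fin: "finite S" "S \<noteq> {}" by (auto simp: S_def)
  have sub: "S \<subseteq> points T" using m(1) vertex_point[OF T] by (auto simp: S_def closed_edge_def)
  from fin obtain x where x: "x \<in> S" "\<And>y. y \<in> S \<Longrightarrow> g x \<le> g y"
    using ex_is_arg_min_if_finite[OF fin, of g] by (auto simp: is_arg_min_linorder)
  have "g x \<le> g y" if y: "y \<in> points T" for y
    using points_cases[OF T y]
  proof cases
    case (1 v)
    then show ?thesis using x(2) by (auto simp: S_def)
  next
    case (2 e)
    then show ?thesis using x(2)[of "m e"] m(2)[OF 2] by (auto simp: S_def)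
  qed
  then show ?thesis using x(1) sub by blast
qed

lemma metric_radius_attained:
  assumes T: "finite_metric_tree T"
  shows "\<exists>v\<in>points T. (\<exists>x\<in>points T. tree_dist T v x = metric_radius T) \<and>
           (\<forall>x\<in>points T. tree_dist T v x \<le> metric_radius T) \<and>
           (\<forall>w\<in>points T. \<exists>x\<in>points T. metric_radius T \<le> tree_dist T w x)"
proof -
  interpret Metric_space "points T" "tree_dist T" by (rule Metric_space_tree[OF T])
  define f where "f v = (SUP x\<in>points T. tree_dist T v x)" for v
  have "\<exists>x\<in>points T. \<forall>y\<in>points T. - tree_dist T v x \<le> - tree_dist T v y" if v: "v \<in> points T" for v
  proof (rule attains_min[OF T])
    fix x y assume "x \<in> points T" "y \<in> points T"
    then show "\<bar>- tree_dist T v x - - tree_dist T v y\<bar> \<le> tree_dist T x y"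
      using triangle[of v x y] triangle[of v y x] v commute[of x y] by auto
  qed
  then obtain p where p: "\<And>v. v \<in> points T \<Longrightarrow> p v \<in> points T"
    "\<And>v y. v \<in> points T \<Longrightarrow> y \<in> points T \<Longrightarrow> tree_dist T v y \<le> tree_dist T v (p v)"
    by (metis neg_le_iff_le)
  have f: "f v = tree_dist T v (p v)" if "v \<in> points T" for v
    unfolding f_def using p that by (intro cSup_eq_maximum) auto
  have "\<exists>v\<in>points T. \<forall>w\<in>points T. f v \<le> f w"
  proof (rule attains_min[OF T])
    fix x y assume xy: "x \<in> points T" "y \<in> points T"
    show "\<bar>f x - f y\<bar> \<le> tree_dist T x y"
      using triangle[of x y "p x"] triangle[of y x "p y"] p(2)[of y "p x"] p(2)[of x "p y"]
        f[OF xy(1)] f[OF xy(2)] xy p(1)[OF xy(1)] p(1)[OF xy(2)] commute[of x y] by auto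
  qed
  then obtain v where v: "v \<in> points T" "\<And>w. w \<in> points T \<Longrightarrow> f v \<le> f w" by blast
  have "metric_radius T = f v"
    unfolding metric_radius_def f_def[symmetric] using v by (intro cInf_eq_minimum) auto
  then show ?thesis using v f p by metis
qed

subsection \<open>The value of the expected radius measure\<close>

lemma space_cover_space: "space (cover_space T) = (SIGMA m:{1..}. covers T m)"
  and sets_cover_space: "sets (cover_space T) = sigma_sets (SIGMA m:{1..}. covers T m)
     {{m} \<times> A | m A. 1 \<le> m \<and> A \<in> sets (restrict_space (Pi\<^sub>M {1..m} (\<lambda>_. borel)) (covers T m))}"
proof -
  have "{{m} \<times> A | m A. 1 \<le> m \<and> A \<in> sets (restrict_space (Pi\<^sub>M {1..m} (\<lambda>_. borel)) (covers T m))}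
    \<subseteq> Pow (SIGMA m:{1..}. covers T m)"
    by (auto simp: sets_restrict_space)
  then show "space (cover_space T) = (SIGMA m:{1..}. covers T m)"
    and "sets (cover_space T) = sigma_sets (SIGMA m:{1..}. covers T m)
     {{m} \<times> A | m A. 1 \<le> m \<and> A \<in> sets (restrict_space (Pi\<^sub>M {1..m} (\<lambda>_. borel)) (covers T m))}"
    by (auto simp: cover_space_def)
qed

lemma radius_count_measurable:
  assumes A: "A \<in> sets nonneg_borel"
  shows "(\<lambda>(m, r). (of_nat (card {i \<in> {1..m}. r i \<in> A}) :: ennreal)) \<in> borel_measurable (cover_space T)"
proof -
  have AB: "A \<in> sets borel" using A by (auto simp: sets_restrict_space)
  define B where "B i m = {r \<in> covers T m. r i \<in> A}" for i m
  have gen: "{m} \<times> B i m \<in> sets (cover_space T)" if "i \<in> {1..m}" for i m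
  proof -
    have "{r \<in> space (Pi\<^sub>M {1..m} (\<lambda>_. borel)). r i \<in> A} \<in> sets (Pi\<^sub>M {1..m} (\<lambda>_. borel :: real measure))"
      using that AB by measurable
    moreover have "B i m = covers T m \<inter> {r \<in> space (Pi\<^sub>M {1..m} (\<lambda>_. borel)). r i \<in> A}"
      by (auto simp: B_def space_PiM covers_def PiE_def)
    ultimately have "B i m \<in> sets (restrict_space (Pi\<^sub>M {1..m} (\<lambda>_. borel)) (covers T m))"
      by (auto simp: sets_restrict_space)
    moreover have "1 \<le> m" using that by simp
    ultimately show ?thesis unfolding sets_cover_space by (intro sigma_sets.Basic) blast
  qed
  have eq: "(\<lambda>(m, r). (of_nat (card {i \<in> {1..m}. r i \<in> A}) :: ennreal)) x
      = (\<Sum>i. \<Sum>m. if i \<in> {1..m} then indicator ({m} \<times> B i m) x else 0)"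
    if x: "x \<in> space (cover_space T)" for x
  proof -
    obtain n r where nr: "x = (n, r)" "r \<in> covers T n" using x by (auto simp: space_cover_space)
    have "(\<Sum>m. if i \<in> {1..m} then indicator ({m} \<times> B i m) x else 0)
        = (if i \<in> {1..n} \<and> r i \<in> A then 1 else (0::ennreal))" for i
      using nr by (subst suminf_finite[of "{n}"]) (auto simp: B_def indicator_def)
    then have "(\<Sum>i. \<Sum>m. if i \<in> {1..m} then indicator ({m} \<times> B i m) x else (0::ennreal))
        = (\<Sum>i. if i \<in> {1..n} \<and> r i \<in> A then 1 else 0)" by simp
    also have "\<dots> = (\<Sum>i\<in>{1..n}. if i \<in> {1..n} \<and> r i \<in> A then 1 else 0)"
      by (rule suminf_finite) auto
    also have "\<dots> = (\<Sum>i\<in>{1..n}. if r i \<in> A then 1 else 0)" by (intro sum.cong) auto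
    also have "\<dots> = of_nat (card {i \<in> {1..n}. r i \<in> A})"
      by (subst sum.If_cases) (auto simp: Int_def)
    finally show ?thesis using nr by simp
  qed
  have "(\<lambda>x. \<Sum>i. \<Sum>m. if i \<in> {1..m} then indicator ({m} \<times> B i m) x else (0::ennreal))
      \<in> borel_measurable (cover_space T)"
  proof (intro borel_measurable_suminf_order)
    fix i m show "(\<lambda>x. if i \<in> {1..m} then indicator ({m} \<times> B i m) x else (0::ennreal))
      \<in> borel_measurable (cover_space T)"
      using gen[of i m] by (cases "i \<in> {1..m}") auto
  qed
  from iffD2[OF measurable_cong[OF eq] this] show ?thesis .
qed

lemma sets_expected_radius_measure [simp]:
  "sets (expected_radius_measure \<nu>) = sets nonneg_borel"
  and space_expected_radius_measure [simp]: "space (expected_radius_measure \<nu>) = {0..}"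
proof -
  have "sets nonneg_borel \<subseteq> Pow {0..}" by (auto simp: sets_restrict_space)
  moreover have "sigma_sets {0..} (sets nonneg_borel) = sets nonneg_borel"
    using sets.sigma_sets_eq[of nonneg_borel] by (simp add: space_restrict_space)
  ultimately show "sets (expected_radius_measure \<nu>) = sets nonneg_borel"
    "space (expected_radius_measure \<nu>) = {0..}"
    by (auto simp: expected_radius_measure_def)
qed

lemma emeasure_expected_radius_measure:
  assumes nu: "sets \<nu> = sets (cover_space T)" and A: "A \<in> sets nonneg_borel"
  shows "emeasure (expected_radius_measure \<nu>) A =
    (\<integral>\<^sup>+(m, r). of_nat (card {i \<in> {1..m}. r i \<in> A}) \<partial>\<nu>)"
proof (rule emeasure_measure_of[OF expected_radius_measure_def])
  show "sets nonneg_borel \<subseteq> Pow {0..}" by (auto simp: sets_restrict_space)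
  show "A \<in> sets (expected_radius_measure \<nu>)" using A by simp
  show "positive (sets (expected_radius_measure \<nu>))
     (\<lambda>A. \<integral>\<^sup>+(m, r). of_nat (card {i \<in> {1..m}. r i \<in> A}) \<partial>\<nu>)"
    by (simp add: positive_def case_prod_unfold)
  show "countably_additive (sets (expected_radius_measure \<nu>))
     (\<lambda>A. \<integral>\<^sup>+(m, r). of_nat (card {i \<in> {1..m}. r i \<in> A}) \<partial>\<nu>)"
  proof (rule countably_additiveI)
    fix F :: "nat \<Rightarrow> real set"
    assume F: "range F \<subseteq> sets (expected_radius_measure \<nu>)" "disjoint_family F"
    have meas: "(\<lambda>(m, r). (of_nat (card {i \<in> {1..m}. r i \<in> F n}) :: ennreal)) \<in> borel_measurable \<nu>" for n
    proof -
      have "F n \<in> sets nonneg_borel" using F(1) unfolding sets_expected_radius_measure by blast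
      from radius_count_measurable[OF this, of T] show ?thesis
        unfolding measurable_cong_sets[OF nu HOL.refl] .
    qed
    have cnt: "(of_nat (card {i \<in> {1..m}. r i \<in> B}) :: ennreal) = (\<Sum>i\<in>{1..m}. indicator B (r i))"
      for m and r :: "nat \<Rightarrow> real" and B
      by (simp add: indicator_def sum.If_cases Int_def)
    have count_UN: "(\<Sum>n. of_nat (card {i \<in> {1..m}. r i \<in> F n}) :: ennreal)
        = of_nat (card {i \<in> {1..m}. r i \<in> (\<Union>n. F n)})" for m and r :: "nat \<Rightarrow> real"
      unfolding cnt using suminf_indicator[OF F(2)] by (subst suminf_sum) simp_all
    have "(\<Sum>n. \<integral>\<^sup>+(m, r). of_nat (card {i \<in> {1..m}. r i \<in> F n}) \<partial>\<nu>)
        = (\<integral>\<^sup>+x. (\<Sum>n. case x of (m, r) \<Rightarrow> of_nat (card {i \<in> {1..m}. r i \<in> F n})) \<partial>\<nu>)"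
      using meas by (intro nn_integral_suminf[symmetric])
    also have "(\<lambda>x :: nat \<times> (nat \<Rightarrow> real). \<Sum>n. case x of (m, r) \<Rightarrow> (of_nat (card {i \<in> {1..m}. r i \<in> F n}) :: ennreal))
        = (\<lambda>(m, r). of_nat (card {i \<in> {1..m}. r i \<in> (\<Union>n. F n)}))"
      unfolding case_prod_unfold by (simp only: count_UN)
    finally show "(\<Sum>n. \<integral>\<^sup>+(m, r). of_nat (card {i \<in> {1..m}. r i \<in> F n}) \<partial>\<nu>)
        = (\<integral>\<^sup>+(m, r). of_nat (card {i \<in> {1..m}. r i \<in> (\<Union>n. F n)}) \<partial>\<nu>)" .
  qed
qed

end

theory Submission
  imports Defs
begin

text \<open>
  A single ball of radius \<open>t\<close> covers \<open>T\<close>, for a suitable centre, exactly when \<open>\<rho> \<le> t\<close>, because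
  the metric radius is attained. A probability measure on one-ball covers is therefore nothing but
  the law of a random radius \<open>t \<ge> \<rho>\<close>, its expected radius measure is that law, and the problem
  becomes one about measures on the real line. The measure \<open>(L / r) U[0, r]\<close> has the constant density
  \<open>L / r\<^sup>2\<close> on \<open>[0, r]\<close>, so it dominates some law carried by \<open>[\<rho>, \<infinity>)\<close> if and only if it gives
  \<open>[\<rho>, \<infinity>)\<close> mass at least one, that is,
  \<open>1 \<le> L (r - \<rho>) / r\<^sup>2\<close>.

  For necessity one evaluates both measures on \<open>[\<rho>, \<infinity>)\<close>. For sufficiency the uniform law on
  \<open>[\<rho>, r]\<close> works: its density is \<open>1 / (r - \<rho>) \<le> L / r\<^sup>2\<close>, and the constraint \<open>t \<le> L\<close> on the total
  radius comes for free, since \<open>r\<^sup>2 \<le> L (r - \<rho>) \<le> L r\<close> forces \<open>r \<le> L\<close>.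
\<close>

section \<open>One-ball covers are the radii above the metric radius\<close>

lemma metric_radius_nonneg:
  assumes T: "finite_metric_tree T"
  shows "0 \<le> metric_radius T"
proof -
  interpret Metric_space "points T" "tree_dist T" by (rule Metric_space_tree[OF T])
  show ?thesis using metric_radius_attained[OF T] nonneg by metis
qed

lemma total_length_nonneg:
  assumes "finite_metric_tree T"
  shows "0 \<le> total_length T"
  using assms unfolding total_length_def finite_metric_tree_def
  by (intro sum_nonneg) (auto intro: less_imp_le)

text \<open>
  A centre realising the metric radius serves for every larger radius; conversely every centre has
  a point of the tree at distance at least the metric radius, which the ball has to reach.
\<close>

lemma covers_one_iff:
  assumes T: "finite_metric_tree T"
  shows "c \<in> covers T 1 \<longleftrightarrow> c \<in> extensional {1} \<and> metric_radius T \<le> c 1"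
proof -
  interpret Metric_space "points T" "tree_dist T" by (rule Metric_space_tree[OF T])
  have "(\<exists>v\<in>points T. points T \<subseteq> tree_ball T v s) \<longleftrightarrow> metric_radius T \<le> s" for s
  proof
    assume "\<exists>v\<in>points T. points T \<subseteq> tree_ball T v s"
    then obtain v where v: "v \<in> points T" "\<And>x. x \<in> points T \<Longrightarrow> tree_dist T x v \<le> s"
      by (auto simp: tree_ball_def)
    obtain x where "x \<in> points T" "metric_radius T \<le> tree_dist T v x"
      using metric_radius_attained[OF T] v(1) by blast
    then show "metric_radius T \<le> s" using v(2)[of x] commute[of x v] by simp
  next
    assume s: "metric_radius T \<le> s"
    obtain v where v: "v \<in> points T" "\<And>x. x \<in> points T \<Longrightarrow> tree_dist T v x \<le> metric_radius T"
      using metric_radius_attained[OF T] by blast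
    have "tree_dist T x v \<le> s" if "x \<in> points T" for x
      using v(2)[OF that] s commute[of x v] by simp
    then show "\<exists>v\<in>points T. points T \<subseteq> tree_ball T v s"
      using v(1) by (auto simp: tree_ball_def)
  qed
  moreover have "(\<exists>v\<in>{1..1} \<rightarrow> points T. points T \<subseteq> (\<Union>i\<in>{1..1}. tree_ball T (v i) (c i)))
      \<longleftrightarrow> (\<exists>v\<in>points T. points T \<subseteq> tree_ball T v (c 1))" (is "?tuple \<longleftrightarrow> ?single")
  proof
    show "?tuple \<Longrightarrow> ?single" by auto
    assume ?single
    then obtain v where "v \<in> points T" "points T \<subseteq> tree_ball T v (c 1)" by blast
    then show ?tuple by (intro bexI[of _ "\<lambda>_. v"]) auto
  qed
  ultimately show ?thesis
    using metric_radius_nonneg[OF T] by (auto simp: covers_def PiE_iff)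
qed

text \<open>
  Radii below the metric radius are raised to it, so that every real number gives a cover and
  the map can transport a measure from the whole real line.
\<close>

definition one_ball :: "'v weighted_graph \<Rightarrow> real \<Rightarrow> nat \<times> (nat \<Rightarrow> real)" where
  "one_ball T t = (1, \<lambda>_\<in>{1}. max (metric_radius T) t)"

lemma one_ball_measurable:
  assumes T: "finite_metric_tree T"
  shows "one_ball T \<in> borel \<rightarrow>\<^sub>M cover_space T"
proof (rule measurable_sigma_sets[OF sets_cover_space])
  show "{{m} \<times> A | m A. 1 \<le> m \<and> A \<in> sets (restrict_space (Pi\<^sub>M {1..m} (\<lambda>_. borel)) (covers T m))}
      \<subseteq> Pow (SIGMA m:{1..}. covers T m)"
    by (auto simp: sets_restrict_space)
  have cov: "(\<lambda>_\<in>{1}. max (metric_radius T) t) \<in> covers T 1" for t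
    unfolding covers_one_iff[OF T] by simp
  then show "one_ball T \<in> space borel \<rightarrow> (SIGMA m:{1..}. covers T m)"
    by (auto simp: one_ball_def)
  fix X
  assume "X \<in> {{m} \<times> A | m A. 1 \<le> m \<and> A \<in> sets (restrict_space (Pi\<^sub>M {1..m} (\<lambda>_. borel)) (covers T m))}"
  then obtain m A where X: "X = {m} \<times> A"
    and "A \<in> sets (restrict_space (Pi\<^sub>M {1..m} (\<lambda>_. borel)) (covers T m))" by blast
  then obtain B where B: "B \<in> sets (Pi\<^sub>M {1..m} (\<lambda>_. borel))" "A = covers T m \<inter> B"
    by (auto simp: sets_restrict_space)
  show "one_ball T -` X \<inter> space borel \<in> sets borel"
  proof (cases "m = 1")
    case True
    have "(\<lambda>t. \<lambda>_\<in>{1..1::nat}. max (metric_radius T) t) \<in> borel \<rightarrow>\<^sub>M Pi\<^sub>M {1..1} (\<lambda>_. borel)"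
      by measurable
    from measurable_sets[OF this] B(1) True
    have "(\<lambda>t. \<lambda>_\<in>{1..1::nat}. max (metric_radius T) t) -` B \<inter> space borel \<in> sets borel" by blast
    moreover have "one_ball T -` X = (\<lambda>t. \<lambda>_\<in>{1..1::nat}. max (metric_radius T) t) -` B"
      using cov by (auto simp: one_ball_def X B(2) True)
    ultimately show ?thesis by simp
  next
    case False
    then have "one_ball T -` X = {}" by (auto simp: one_ball_def X)
    then show ?thesis by simp
  qed
qed

text \<open>
  Lets an almost-everywhere statement about a pushforward along \<open>one_ball T\<close> be read off on the
  real line.
\<close>

lemma one_ball_covers0_measurable: "one_ball_covers T \<inter> covers0 T \<in> sets (cover_space T)"
proof -
  define B where "B = {c \<in> space (Pi\<^sub>M {1..1::nat} (\<lambda>_. borel :: real measure)). c 1 \<le> total_length T}"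
  have "B \<in> sets (Pi\<^sub>M {1..1::nat} (\<lambda>_. borel))"
    unfolding B_def by measurable
  then have "covers T 1 \<inter> B \<in> sets (restrict_space (Pi\<^sub>M {1..1} (\<lambda>_. borel)) (covers T 1))"
    by (auto simp: sets_restrict_space)
  then have "{1} \<times> (covers T 1 \<inter> B) \<in> sets (cover_space T)"
    unfolding sets_cover_space by (intro sigma_sets.Basic) blast
  moreover have "covers T 1 \<subseteq> {1..1} \<rightarrow>\<^sub>E UNIV" unfolding covers_def by fastforce
  then have "one_ball_covers T \<inter> covers0 T = {1} \<times> (covers T 1 \<inter> B)"
    by (auto simp: one_ball_covers_def covers0_def B_def space_PiM)
  ultimately show ?thesis by simp
qed

section \<open>Evaluating the two measures\<close>

lemma card_one_index: "card {i \<in> {1..1::nat}. P i} = (if P 1 then 1 else 0)"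
proof -
  have "{i \<in> {1..1::nat}. P i} = (if P 1 then {1} else {})" by auto
  then show ?thesis by simp
qed

lemma emeasure_scaled_uniform:
  assumes "0 < r" and A: "A \<in> sets nonneg_borel"
  shows "emeasure (scale_measure c (uniform_on_nonneg r)) A
    = c * (emeasure lborel ({0..r} \<inter> A) / ennreal r)"
proof -
  have "A \<in> sets borel" "A \<subseteq> {0..}" using A by (auto simp: sets_restrict_space)
  then show ?thesis using assms(1)
    by (simp add: uniform_on_nonneg_def emeasure_restrict_space)
qed

lemma emeasure_expected_radius_one_ball:
  assumes T: "finite_metric_tree T" and M: "sets M = sets borel" and A: "A \<in> sets nonneg_borel"
  shows "emeasure (expected_radius_measure (distr M (cover_space T) (one_ball T))) A
    = (\<integral>\<^sup>+t. indicator A (max (metric_radius T) t) \<partial>M)"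
proof -
  have meas: "one_ball T \<in> M \<rightarrow>\<^sub>M cover_space T"
    using one_ball_measurable[OF T] M by (simp cong: measurable_cong_sets)
  have "emeasure (expected_radius_measure (distr M (cover_space T) (one_ball T))) A
      = (\<integral>\<^sup>+(m, c). of_nat (card {i \<in> {1..m}. c i \<in> A}) \<partial>distr M (cover_space T) (one_ball T))"
    by (rule emeasure_expected_radius_measure[OF sets_distr A])
  also have "\<dots> = (\<integral>\<^sup>+t. (case one_ball T t of (m, c) \<Rightarrow> of_nat (card {i \<in> {1..m}. c i \<in> A})) \<partial>M)"
    by (rule nn_integral_distr[OF meas], unfold measurable_distr_eq1)
      (rule radius_count_measurable[OF A])
  also have "\<dots> = (\<integral>\<^sup>+t. indicator A (max (metric_radius T) t) \<partial>M)"
    unfolding one_ball_def prod.case card_one_index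
    by (intro nn_integral_cong) (auto simp: indicator_def)
  finally show ?thesis .
qed

section \<open>The criterion\<close>

text \<open>
  Test the domination on the half-line \<open>[\<rho>, \<infinity>)\<close>, which contains the radius of every one-ball
  cover: there the expected radius measure has mass exactly one.
\<close>

lemma one_ball_domination_necessary:
  assumes T: "finite_metric_tree T" and r: "0 < r"
    and nu: "sets \<nu> = sets (cover_space T)" "prob_space \<nu>"
    and one: "AE c in \<nu>. c \<in> one_ball_covers T"
    and dom: "\<And>A. A \<in> sets nonneg_borel \<Longrightarrow> emeasure (expected_radius_measure \<nu>) A
      \<le> emeasure (scale_measure (ennreal (K / r)) (uniform_on_nonneg r)) A"
  shows "r\<^sup>2 \<le> K * (r - metric_radius T)"
proof -
  interpret prob_space \<nu> by (rule nu(2))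
  let ?\<rho> = "metric_radius T"
  have \<rho>: "0 \<le> ?\<rho>" by (rule metric_radius_nonneg[OF T])
  have A: "{?\<rho>..} \<in> sets nonneg_borel" using \<rho> by (auto simp: sets_restrict_space)
  have "emeasure (expected_radius_measure \<nu>) {?\<rho>..}
      = (\<integral>\<^sup>+(m, c). of_nat (card {i \<in> {1..m}. c i \<in> {?\<rho>..}}) \<partial>\<nu>)"
    by (rule emeasure_expected_radius_measure[OF nu(1) A])
  also have "\<dots> = (\<integral>\<^sup>+_. 1 \<partial>\<nu>)"
  proof (rule nn_integral_cong_AE)
    show "AE x in \<nu>. (case x of (m, c) \<Rightarrow> of_nat (card {i \<in> {1..m}. c i \<in> {?\<rho>..}})) = (1 :: ennreal)"
      using one
    proof eventually_elim
      case (elim x)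
      then obtain c where "x = (1, c)" "?\<rho> \<le> c 1"
        using covers_one_iff[OF T] by (auto simp: one_ball_covers_def)
      then show ?case unfolding \<open>x = _\<close> prod.case card_one_index by simp
    qed
  qed
  also have "\<dots> = 1" by (simp add: emeasure_space_1)
  finally have mass: "1 \<le> ennreal (K / r) * (emeasure lborel ({0..r} \<inter> {?\<rho>..}) / ennreal r)"
    using dom[OF A] unfolding emeasure_scaled_uniform[OF r A] by simp
  have int: "{0..r} \<inter> {?\<rho>..} = {?\<rho>..r}" using \<rho> by auto
  have le: "?\<rho> \<le> r"
    using mass unfolding int by (cases "?\<rho> \<le> r") auto
  have K: "0 \<le> K / r"
    using mass by (cases "0 \<le> K / r") (auto simp: ennreal_neg)
  have "ennreal 1 \<le> ennreal (K / r) * ennreal ((r - ?\<rho>) / r)"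
    using mass le r unfolding int by (simp add: divide_ennreal)
  also have "\<dots> = ennreal (K / r * ((r - ?\<rho>) / r))"
    using K le r by (intro ennreal_mult[symmetric]) auto
  finally have "1 \<le> K / r * ((r - ?\<rho>) / r)"
    using K le r by (simp add: ennreal_le_iff)
  then show ?thesis using r by (simp add: field_simps power2_eq_square)
qed

lemma one_ball_domination_sufficient:
  assumes T: "finite_metric_tree T" and r: "0 < r"
    and le: "r\<^sup>2 \<le> total_length T * (r - metric_radius T)"
  shows "\<exists>\<nu>. sets \<nu> = sets (cover_space T) \<and> prob_space \<nu> \<and>
    (AE c in \<nu>. c \<in> one_ball_covers T \<inter> covers0 T) \<and>
    (\<forall>A\<in>sets nonneg_borel. emeasure (expected_radius_measure \<nu>) A
       \<le> emeasure (scale_measure (ennreal (total_length T / r)) (uniform_on_nonneg r)) A)"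
proof -
  let ?\<rho> = "metric_radius T" and ?L = "total_length T"
  have \<rho>: "0 \<le> ?\<rho>" by (rule metric_radius_nonneg[OF T])
  have "0 < r\<^sup>2" using r by simp
  then have "0 < ?L * (r - ?\<rho>)" using le by linarith
  then have L: "0 < ?L" and gap: "?\<rho> < r"
    using total_length_nonneg[OF T] by (auto simp: zero_less_mult_iff)
  have "?L * (r - ?\<rho>) \<le> ?L * r" using \<rho> L by (intro mult_left_mono) auto
  then have "r * r \<le> ?L * r" using le by (simp add: power2_eq_square)
  then have rL: "r \<le> ?L" using r by simp
  define M where "M = uniform_measure lborel {?\<rho>..r}"
  have M: "sets M = sets borel" by (simp add: M_def)
  have meas: "one_ball T \<in> M \<rightarrow>\<^sub>M cover_space T"
    using one_ball_measurable[OF T] M by (simp cong: measurable_cong_sets)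
  interpret M: prob_space M
    unfolding M_def using gap by (intro prob_space_uniform_measure) auto
  have range: "AE t in M. t \<in> {?\<rho>..r}"
    unfolding M_def using gap by (intro AE_uniform_measureI) auto
  define \<nu> where "\<nu> = distr M (cover_space T) (one_ball T)"
  have "AE c in \<nu>. c \<in> one_ball_covers T \<inter> covers0 T"
    unfolding \<nu>_def
  proof (subst AE_distr_iff[OF meas])
    have "{c \<in> space (cover_space T). c \<in> one_ball_covers T \<inter> covers0 T} = one_ball_covers T \<inter> covers0 T"
      by (auto simp: space_cover_space one_ball_covers_def)
    then show "{c \<in> space (cover_space T). c \<in> one_ball_covers T \<inter> covers0 T} \<in> sets (cover_space T)"
      using one_ball_covers0_measurable by simp
    show "AE t in M. one_ball T t \<in> one_ball_covers T \<inter> covers0 T"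
      using range
    proof eventually_elim
      case (elim t)
      then have "max ?\<rho> t \<le> ?L" using rL by auto
      then show ?case
        using covers_one_iff[OF T, of "\<lambda>_\<in>{1}. max ?\<rho> t"]
        by (simp add: one_ball_def one_ball_covers_def covers0_def)
    qed
  qed
  moreover have "emeasure (expected_radius_measure \<nu>) A
      \<le> emeasure (scale_measure (ennreal (?L / r)) (uniform_on_nonneg r)) A"
    if A: "A \<in> sets nonneg_borel" for A
  proof -
    have AB: "A \<in> sets borel" using A by (auto simp: sets_restrict_space)
    have "emeasure (expected_radius_measure \<nu>) A = (\<integral>\<^sup>+t. indicator A (max ?\<rho> t) \<partial>M)"
      unfolding \<nu>_def by (rule emeasure_expected_radius_one_ball[OF T M A])
    \<comment> \<open>\<open>M\<close> lives on radii at least \<open>\<rho>\<close>, where the truncation in \<open>one_ball\<close> has no effect.\<close>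
    also have "\<dots> = (\<integral>\<^sup>+t. indicator A t \<partial>M)"
      using range by (intro nn_integral_cong_AE) (auto simp: max_def elim!: eventually_mono)
    also have "\<dots> = emeasure lborel ({?\<rho>..r} \<inter> A) / ennreal (r - ?\<rho>)"
      using AB gap by (simp add: M_def)
    also have "\<dots> = ennreal (1 / (r - ?\<rho>)) * emeasure lborel ({?\<rho>..r} \<inter> A)"
      using gap by (simp add: divide_ennreal_def inverse_ennreal mult.commute inverse_eq_divide)
    also have "\<dots> \<le> ennreal (?L / r * (1 / r)) * emeasure lborel ({0..r} \<inter> A)"
    proof (rule mult_mono)
      show "ennreal (1 / (r - ?\<rho>)) \<le> ennreal (?L / r * (1 / r))"
        using le gap r by (intro ennreal_leI) (simp add: field_simps power2_eq_square)
      show "emeasure lborel ({?\<rho>..r} \<inter> A) \<le> emeasure lborel ({0..r} \<inter> A)"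
        using \<rho> AB by (intro emeasure_mono) auto
    qed auto
    also have "\<dots> = ennreal (?L / r) * (emeasure lborel ({0..r} \<inter> A) / ennreal r)"
      using L r by (simp only: ennreal_mult divide_ennreal_def inverse_ennreal mult_ac inverse_eq_divide less_imp_le divide_nonneg_pos zero_le_one)
    finally show ?thesis unfolding emeasure_scaled_uniform[OF r A] .
  qed
  moreover have "sets \<nu> = sets (cover_space T)" by (simp add: \<nu>_def)
  moreover have "prob_space \<nu>" unfolding \<nu>_def by (rule M.prob_space_distr[OF meas])
  ultimately show ?thesis by blast
qed

theorem proposition5p6:
  fixes T :: "'v weighted_graph" and L \<rho> r :: real
  assumes "finite_metric_tree T" and "\<not> is_singleton (points T)"
    and "L = total_length T" and "\<rho> = metric_radius T" and "0 < r"
  shows "(\<exists>\<nu>. sets \<nu> = sets (cover_space T) \<and> prob_space \<nu> \<and>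
            (AE c in \<nu>. c \<in> one_ball_covers T \<inter> covers0 T) \<and>
            (\<forall>A\<in>sets nonneg_borel. emeasure (expected_radius_measure \<nu>) A
                \<le> emeasure (scale_measure (ennreal (L / r)) (uniform_on_nonneg r)) A))
         \<longleftrightarrow> r\<^sup>2 \<le> L * (r - \<rho>)"
    (is "?dominated \<longleftrightarrow> _")
proof
  assume ?dominated
  then show "r\<^sup>2 \<le> L * (r - \<rho>)"
    unfolding \<open>\<rho> = _\<close>
    by (elim exE conjE) (rule one_ball_domination_necessary[OF assms(1,5)], auto)
next
  assume "r\<^sup>2 \<le> L * (r - \<rho>)"
  then show ?dominated
    unfolding \<open>L = _\<close> \<open>\<rho> = _\<close> by (rule one_ball_domination_sufficient[OF assms(1,5)])
qed

end
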